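(* Let $(P,\sqcup,\sqcap,0,1)$ be an operator structure. Define a binary relation $\le$ on $P$ by $x\le y$ if $x\sqcup y=y$. Then $(P,\le,0,1)$ is a bounded poset (with bottom $0$ and top $1$) satisfying: (a) $x\le y$ if and only if $x\sqcap y=x$; (b) $x\sqcup y=\operatorname{Min}U(x,y)$ for all $x,y\in P$; (c) $x\sqcap y=\operatorname{Max}L(x,y)$ for all $x,y\in P$, where $\operatorname{Min}U$ and $\operatorname{Max}L$ are computed in $(P,\le)$.
   Context: A binary operator on a set $P$ assigns to each pair of elements of $P$ a subset of $P$, and is also defined on pairs of subsets of $P$; elements are identified with singletons, so e.g. "$x\sqcup y=y$" means $x\sqcup y=\{y\}$. An operator structure is $(P,\sqcup,\sqcap,0,1)$ with binary operators $\sqcup,\sqcap$ on $P$ and $0,1\in P$ such that for all $x,y,z\in P$: (i) $x\sqcup x=x$ and $x\sqcap x=x$; (ii) $x\sqcup y=y\sqcup x$ and $x\sqcap y=y\sqcap x$; (iii) $0\sqcup x=x$ and $x\sqcap 1=x$; (iv) $x\sqcup((x\sqcup y)\sqcup z)=0\sqcup((x\sqcup y)\sqcup z)$ and $x\sqcap((x\sqcap y)\sqcap z)=((x\sqcap y)\sqcap z)\sqcap 1$; (v) $(x\sqcap y)\sqcup y=y$ and $x\sqcap(x\sqcup y)=x$; (vi) $z\in x\sqcup y$ if and only if [$x\sqcup z=y\sqcup z=z$, and for every $u\in P$ with $x\sqcup u=y\sqcup u=u\sqcap z=u$ we have $u=z$]; and $z\in x\sqcap y$ if and only if [$z\sqcap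 x=z\sqcap y=z$, and for every $u\in P$ with $u\sqcap x=u\sqcap y=z\sqcup u=u$ we have $u=z$]. In a poset, $L(x,y)$ and $U(x,y)$ are the sets of common lower and upper bounds of $x,y$, and $\operatorname{Max}L(x,y)$, $\operatorname{Min}U(x,y)$ are the sets of maximal elements of $L(x,y)$ and minimal elements of $U(x,y)$. *)

theory Defs
  imports Main
begin

text \<open>
  A binary operator on \<open>P\<close> acts on pairs of elements and on pairs of subsets of \<open>P\<close>,
  with elements identified with singletons.  We therefore model it as a single function on
  pairs of subsets; its value at elements \<open>x\<close>, \<open>y\<close> is its value at \<open>{x}\<close>, \<open>{y}\<close>.  No link
  is imposed between the values at singletons and the values at other subsets, so both
  the elementwise extension and \<open>Min U(A, B)\<close> are instances.
\<close>

definition binary_operator_on :: "'a set \<Rightarrow> ('a set \<Rightarrow> 'a set \<Rightarrow> 'a set) \<Rightarrow> bool" where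
  "binary_operator_on P f \<longleftrightarrow> (\<forall>A B. A \<subseteq> P \<longrightarrow> B \<subseteq> P \<longrightarrow> f A B \<subseteq> P)"

locale operator_structure =
  fixes P :: "'a set"
    and join :: "'a set \<Rightarrow> 'a set \<Rightarrow> 'a set"  (infixl \<open>\<squnion>\<close> 65)
    and meet :: "'a set \<Rightarrow> 'a set \<Rightarrow> 'a set"  (infixl \<open>\<sqinter>\<close> 65)
    and zero :: 'a  (\<open>\<zero>\<close>)
    and one :: 'a  (\<open>\<one>\<close>)
  assumes join_operator: "binary_operator_on P (\<squnion>)"
    and meet_operator: "binary_operator_on P (\<sqinter>)"
    and zero_closed: "\<zero> \<in> P"
    and one_closed: "\<one> \<in> P"
    and join_idem: "x \<in> P \<Longrightarrow> {x} \<squnion> {x} = {x}"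
    and meet_idem: "x \<in> P \<Longrightarrow> {x} \<sqinter> {x} = {x}"
    and join_comm: "x \<in> P \<Longrightarrow> y \<in> P \<Longrightarrow> {x} \<squnion> {y} = {y} \<squnion> {x}"
    and meet_comm: "x \<in> P \<Longrightarrow> y \<in> P \<Longrightarrow> {x} \<sqinter> {y} = {y} \<sqinter> {x}"
    and zero_join: "x \<in> P \<Longrightarrow> {\<zero>} \<squnion> {x} = {x}"
    and meet_one: "x \<in> P \<Longrightarrow> {x} \<sqinter> {\<one>} = {x}"
    and join_weak_assoc: "x \<in> P \<Longrightarrow> y \<in> P \<Longrightarrow> z \<in> P \<Longrightarrow>
      {x} \<squnion> (({x} \<squnion> {y}) \<squnion> {z}) = {\<zero>} \<squnion> (({x} \<squnion> {y}) \<squnion> {z})"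
    and meet_weak_assoc: "x \<in> P \<Longrightarrow> y \<in> P \<Longrightarrow> z \<in> P \<Longrightarrow>
      {x} \<sqinter> (({x} \<sqinter> {y}) \<sqinter> {z}) = (({x} \<sqinter> {y}) \<sqinter> {z}) \<sqinter> {\<one>}"
    and meet_join_absorb: "x \<in> P \<Longrightarrow> y \<in> P \<Longrightarrow> ({x} \<sqinter> {y}) \<squnion> {y} = {y}"
    and join_meet_absorb: "x \<in> P \<Longrightarrow> y \<in> P \<Longrightarrow> {x} \<sqinter> ({x} \<squnion> {y}) = {x}"
    and mem_join_iff: "x \<in> P \<Longrightarrow> y \<in> P \<Longrightarrow> z \<in> P \<Longrightarrow>
      z \<in> {x} \<squnion> {y} \<longleftrightarrow>
        {x} \<squnion> {z} = {z} \<and> {y} \<squnion> {z} = {z} \<and>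
        (\<forall>u\<in>P. {x} \<squnion> {u} = {u} \<and> {y} \<squnion> {u} = {u} \<and> {u} \<sqinter> {z} = {u} \<longrightarrow> u = z)"
    and mem_meet_iff: "x \<in> P \<Longrightarrow> y \<in> P \<Longrightarrow> z \<in> P \<Longrightarrow>
      z \<in> {x} \<sqinter> {y} \<longleftrightarrow>
        {z} \<sqinter> {x} = {z} \<and> {z} \<sqinter> {y} = {z} \<and>
        (\<forall>u\<in>P. {u} \<sqinter> {x} = {u} \<and> {u} \<sqinter> {y} = {u} \<and> {z} \<squnion> {u} = {u} \<longrightarrow> u = z)"

definition operator_le :: "'a set \<Rightarrow> ('a set \<Rightarrow> 'a set \<Rightarrow> 'a set) \<Rightarrow> 'a rel" where
  "operator_le P join = relation_of (\<lambda>x y. join {x} {y} = {y}) P"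

definition bounded_poset_on :: "'a set \<Rightarrow> 'a rel \<Rightarrow> 'a \<Rightarrow> 'a \<Rightarrow> bool" where
  "bounded_poset_on P r b t \<longleftrightarrow>
    partial_order_on P r \<and> b \<in> P \<and> t \<in> P \<and> (\<forall>x\<in>P. (b, x) \<in> r \<and> (x, t) \<in> r)"

definition minimal_elements :: "'a rel \<Rightarrow> 'a set \<Rightarrow> 'a set" where
  "minimal_elements r A = {z \<in> A. \<forall>u\<in>A. (u, z) \<in> r \<longrightarrow> u = z}"

definition maximal_elements :: "'a rel \<Rightarrow> 'a set \<Rightarrow> 'a set" where
  "maximal_elements r A = {z \<in> A. \<forall>u\<in>A. (z, u) \<in> r \<longrightarrow> u = z}"

text \<open>
  \<open>U(x, y)\<close> and \<open>L(x, y)\<close> are \<^term>\<open>Above r {x, y}\<close> and \<^term>\<open>Under r {x, y}\<close>; these range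
  over \<^term>\<open>Field r\<close>, which is \<open>P\<close> whenever \<^term>\<open>partial_order_on P r\<close>.
\<close>

end

theory Submission
  imports Defs
begin

text \<open>Absorption makes \<open>{x} \<squnion> {y} = {y}\<close> and
  \<open>{x} \<sqinter> {y} = {x}\<close> equivalent (\<open>join_eq_iff_meet_eq\<close>), so both
  operators induce the same relation. Idempotence, commutativity and weak associativity make it
  reflexive, antisymmetric and transitive; the unit laws give the bounds. Read through this order,
  the membership axioms for joins and meets say exactly "minimal upper bound" and "maximal lower
  bound".\<close>

context operator_structure
begin

abbreviation le :: "'a rel" where "le \<equiv> operator_le P (\<squnion>)"

lemma le_iff_join: "(x, y) \<in> le \<longleftrightarrow> x \<in> P \<and> y \<in> P \<and> {x} \<squnion> {y} = {y}"
  by (simp add: operator_le_def relation_of_def)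

text \<open>Substituting either equation into the matching absorption law yields the other.\<close>

lemma join_eq_iff_meet_eq:
  assumes "x \<in> P" "y \<in> P"
  shows "{x} \<squnion> {y} = {y} \<longleftrightarrow> {x} \<sqinter> {y} = {x}"
  using join_meet_absorb[OF assms] meet_join_absorb[OF assms] by auto

lemma le_iff_meet: "(x, y) \<in> le \<longleftrightarrow> x \<in> P \<and> y \<in> P \<and> {x} \<sqinter> {y} = {x}"
  by (simp add: le_iff_join join_eq_iff_meet_eq cong: conj_cong)

text \<open>Weak associativity suffices: when \<open>x\<close> is below \<open>y\<close> and
  \<open>y\<close> below \<open>z\<close>, the inner term collapses to \<open>{z}\<close>, leaving
  \<open>{x} \<squnion> {z} = {\<zero>} \<squnion> {z} = {z}\<close>.\<close>

lemma le_trans: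
  assumes "(x, y) \<in> le" "(y, z) \<in> le"
  shows "(x, z) \<in> le"
proof -
  have "x \<in> P" "y \<in> P" "z \<in> P" "{x} \<squnion> {y} = {y}" "{y} \<squnion> {z} = {z}"
    using assms by (auto simp: le_iff_join)
  then show ?thesis
    using join_weak_assoc[of x y z] zero_join[of z] by (simp add: le_iff_join)
qed

lemma partial_order_le: "partial_order_on P le"
  unfolding partial_order_on_def preorder_on_def
proof (intro conjI)
  show "le \<subseteq> P \<times> P"
    by (auto simp: le_iff_join)
  show "refl_on P le"
    by (auto simp: refl_on_def le_iff_join join_idem)
  show "trans le"
    by (blast intro: transI le_trans)
  show "antisym le"
  proof (rule antisymI)
    fix x y
    assume "(x, y) \<in> le" "(y, x) \<in> le"
    \<comment> \<open>Commutativity equates the two joins, whose values are \<open>{y}\<close> and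
      \<open>{x}\<close>.\<close>
    then show "x = y"
      using join_comm[of x y] by (simp add: le_iff_join)
  qed
qed

lemma bounded_poset_le: "bounded_poset_on P le \<zero> \<one>"
  unfolding bounded_poset_on_def
  by (simp add: partial_order_le zero_closed one_closed le_iff_join[of \<zero>] zero_join
      le_iff_meet[of _ \<one>] meet_one)

text \<open>Needed because \<open>Above\<close> and \<open>Under\<close> range over the field of the
  relation.\<close>

lemma Field_le: "Field le = P"
proof (intro equalityI subsetI)
  fix x
  show "x \<in> P" if "x \<in> Field le"
    using that by (auto simp: Field_def le_iff_join)
  show "x \<in> Field le" if "x \<in> P"
    using that by (intro FieldI1[of x x]) (simp add: le_iff_join join_idem)
qed

lemma join_eq_iff_le: "x \<in> P \<Longrightarrow> y \<in> P \<Longrightarrow> {x} \<squnion> {y} = {y} \<longleftrightarrow> (x, y) \<in> le"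
  by (simp add: le_iff_join)

lemma meet_eq_iff_le: "x \<in> P \<Longrightarrow> y \<in> P \<Longrightarrow> {x} \<sqinter> {y} = {x} \<longleftrightarrow> (x, y) \<in> le"
  by (simp add: le_iff_meet)

text \<open>The axiom \<open>mem_join_iff\<close> expresses upper bounds by joins but comparison of
  \<open>u\<close> with \<open>z\<close> by a meet; both become \<open>le\<close>, and the axiom
  turns into the definition of a minimal upper bound.\<close>

lemma join_eq_minimal:
  assumes "x \<in> P" "y \<in> P"
  shows "{x} \<squnion> {y} = minimal_elements le (Above le {x, y})"
proof -
  have "z \<in> {x} \<squnion> {y} \<longleftrightarrow> z \<in> minimal_elements le (Above le {x, y})" if "z \<in> P" for z
    unfolding mem_join_iff[OF assms that]
    using assms that
    by (simp add: minimal_elements_def Above_def Field_le join_eq_iff_le meet_eq_iff_le cong: ball_cong)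
      blast
  \<comment> \<open>The axiom decides membership only for elements of \<open>P\<close>, so both
    sides must be shown to lie in \<open>P\<close>.\<close>
  moreover have "{x} \<squnion> {y} \<subseteq> P"
    using join_operator assms by (simp add: binary_operator_on_def)
  moreover have "minimal_elements le (Above le {x, y}) \<subseteq> P"
    by (auto simp: minimal_elements_def Above_def Field_le)
  ultimately show ?thesis
    by blast
qed

text \<open>Dual argument, from \<open>mem_meet_iff\<close>: here lower bounds are expressed by
  meets and the comparison of \<open>z\<close> with \<open>u\<close> by a join.\<close>

lemma meet_eq_maximal:
  assumes "x \<in> P" "y \<in> P"
  shows "{x} \<sqinter> {y} = maximal_elements le (Under le {x, y})"
proof -
  have "z \<in> {x} \<sqinter> {y} \<longleftrightarrow> z \<in> maximal_elements le (Under le {x, y})" if "z \<in> P" for z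
    unfolding mem_meet_iff[OF assms that]
    using assms that
    by (simp add: maximal_elements_def Under_def Field_le join_eq_iff_le meet_eq_iff_le cong: ball_cong)
      blast
  moreover have "{x} \<sqinter> {y} \<subseteq> P"
    using meet_operator assms by (simp add: binary_operator_on_def)
  moreover have "maximal_elements le (Under le {x, y}) \<subseteq> P"
    by (auto simp: maximal_elements_def Under_def Field_le)
  ultimately show ?thesis
    by blast
qed

end

theorem theorem3p3:
  fixes P :: "'a set"
    and join :: "'a set \<Rightarrow> 'a set \<Rightarrow> 'a set"  (infixl \<open>\<squnion>\<close> 65)
    and meet :: "'a set \<Rightarrow> 'a set \<Rightarrow> 'a set"  (infixl \<open>\<sqinter>\<close> 65)
    and zero one :: 'a
    and le :: "'a rel"
  defines "le \<equiv> operator_le P (\<squnion>)"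
  assumes "operator_structure P (\<squnion>) (\<sqinter>) zero one"
  shows "bounded_poset_on P le zero one \<and>
    (\<forall>x\<in>P. \<forall>y\<in>P. (x, y) \<in> le \<longleftrightarrow> {x} \<sqinter> {y} = {x}) \<and>
    (\<forall>x\<in>P. \<forall>y\<in>P. {x} \<squnion> {y} = minimal_elements le (Above le {x, y})) \<and>
    (\<forall>x\<in>P. \<forall>y\<in>P. {x} \<sqinter> {y} = maximal_elements le (Under le {x, y}))"
proof -
  interpret operator_structure P "(\<squnion>)" "(\<sqinter>)" zero one
    by fact
  show ?thesis
    unfolding le_def
    by (intro conjI ballI bounded_poset_le join_eq_minimal meet_eq_maximal) (simp_all add: le_iff_meet)
qed

end
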